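(* Fix $v_0>0$, $0<\gamma<1$, and $a_n\downarrow0$. On a compact neighborhood of $v_0$ in $(0,\infty)$, define \[ \widetilde v_n(v)=v+\gamma a_n\tanh\{(v-v_0)/a_n\},\qquad Y_{n,v}=h+\sqrt{\widetilde v_n(v)}\,Z,\quad h\in\mathbb R, \] with $Z\sim N(0,1)$. Then $v\mapsto\widetilde v_n(v)$ is increasing, and for every fixed $v$ the experiment converges (in total variation), uniformly over translations $h$, to the Gaussian location experiment of variance $v$. Nevertheless, for every $\delta_n>0$ with $\delta_n/a_n\to0$, \[ \frac{R_{n,\infty}(v_0+\delta_n)-R_{n,\infty}(v_0)}{\delta_n}\longrightarrow1+\gamma, \] where $R_{n,\infty}(v)$ is the unrestricted (over $h\in\mathbb R$) minimax squared-error risk for estimating $h$ from $Y_{n,v}$. The same conclusion holds with $R_{n,\infty}$ replaced by the minimax risk $R_{n,H_n}(v)$ on $h\in[-H_n,H_n]$ whenever $H_n\to\infty$ and $H_n^{-2}=o(\delta_n)$.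
   Context: For an experiment $Y_{n,v}$ with parameter $h$, $R_{n,H}(v)=\inf_T\sup_{|h|\le H}\mathbb E_h\{T(Y_{n,v})-h\}^2$, and $R_{n,\infty}(v)$ is the analogous quantity with supremum over $h\in\mathbb R$. The Gaussian location experiment of variance $v$ is $\{N(h,v):h\in\mathbb R\}$; uniform convergence over translations means $\sup_{h}\|N(h,\widetilde v_n(v))-N(h,v)\|_{TV}\to0$. Since $a_n\to0$, $\widetilde v_n>0$ on the compact neighborhood for all large $n$. *)

theory Defs
  imports "HOL-Probability.Probability" "HOL-Library.Landau_Symbols"
begin

(* An experiment is a family of laws indexed by the parameter h. *)

definition location_experiment :: "real \<Rightarrow> real \<Rightarrow> real measure" where
  "location_experiment w h =
     distr (density lborel std_normal_density) borel (\<lambda>z. h + sqrt w * z)"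

(* N(h, v): the second argument of normal_density is the standard deviation. *)
definition gaussian_location :: "real \<Rightarrow> real \<Rightarrow> real measure" where
  "gaussian_location v h = density lborel (normal_density h (sqrt v))"

definition perturbed_variance :: "real \<Rightarrow> real \<Rightarrow> real \<Rightarrow> real \<Rightarrow> real" where
  "perturbed_variance \<gamma> v0 a v = v + \<gamma> * a * tanh ((v - v0) / a)"

(* Normalised so that the distance between probability measures lies in [0, 1]. *)
definition tv_dist :: "'a measure \<Rightarrow> 'a measure \<Rightarrow> real" where
  "tv_dist M N = (SUP A\<in>sets M. \<bar>measure M A - measure N A\<bar>)"

(* The risk is taken in the extended nonnegative reals, so an estimator without second
   moment has risk infinity rather than the default value 0 of the Bochner integral. *)
definition minimax_risk :: "(real \<Rightarrow> real measure) \<Rightarrow> real set \<Rightarrow> ennreal" where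
  "minimax_risk P \<Theta> =
     (INF T\<in>borel_measurable borel. SUP h\<in>\<Theta>. \<integral>\<^sup>+ y. ennreal ((T y - h)\<^sup>2) \<partial>P h)"

(* Hence enn2real never hits its default value at infinity on these risks. *)
lemma minimax_risk_location_finite: "minimax_risk (location_experiment w) \<Theta> < \<infinity>"
proof -
  let ?c = "\<integral>\<^sup>+ z. ennreal (std_normal_density z * (sqrt w * z)\<^sup>2) \<partial>lborel"
  have "integrable lborel (\<lambda>z. (sqrt w)\<^sup>2 * (std_normal_density z * z ^ 2))"
    by (intro integrable_mult_right integrable_std_normal_moment)
  then have "integrable lborel (\<lambda>z. std_normal_density z * (sqrt w * z)\<^sup>2)"
    by (simp add: power_mult_distrib mult_ac del: real_sqrt_pow2_iff)
  then have fin: "?c < \<infinity>"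
    by (simp add: integrable_iff_bounded abs_mult)
  have risk: "(\<integral>\<^sup>+ y. ennreal ((y - h)\<^sup>2) \<partial>location_experiment w h) = ?c" for h
    unfolding location_experiment_def
    by (simp add: nn_integral_distr nn_integral_density ennreal_mult)
  have "minimax_risk (location_experiment w) \<Theta>
      \<le> (SUP h\<in>\<Theta>. \<integral>\<^sup>+ y. ennreal ((y - h)\<^sup>2) \<partial>location_experiment w h)"
    unfolding minimax_risk_def by (rule INF_lower) simp
  also have "\<dots> \<le> ?c"
    by (rule SUP_least) (simp add: risk)
  finally show ?thesis using fin by (rule le_less_trans)
qed

definition risk_unrestricted :: "real \<Rightarrow> real \<Rightarrow> (nat \<Rightarrow> real) \<Rightarrow> nat \<Rightarrow> real \<Rightarrow> real" where
  "risk_unrestricted \<gamma> v0 a n v =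
     enn2real (minimax_risk (location_experiment (perturbed_variance \<gamma> v0 (a n) v)) UNIV)"

definition risk_restricted ::
    "real \<Rightarrow> real \<Rightarrow> (nat \<Rightarrow> real) \<Rightarrow> nat \<Rightarrow> real \<Rightarrow> real \<Rightarrow> real" where
  "risk_restricted \<gamma> v0 a n H v =
     enn2real (minimax_risk (location_experiment (perturbed_variance \<gamma> v0 (a n) v)) {h. \<bar>h\<bar> \<le> H})"

end

theory Submission
  imports Defs
begin

text \<open>
  For positive variance \<open>w\<close> the estimator \<open>T y = y\<close> has constant risk \<open>w\<close>, while the van Trees
  inequality for the prior with density proportional to \<open>(H\<^sup>2 - h\<^sup>2)\<^sup>2\<close> on \<open>[-H, H]\<close>, whose Fisher
  information is \<open>10 / H\<^sup>2\<close>, bounds the minimax risk over \<open>\<bar>h\<bar> \<le> H\<close> below by \<open>w - 10 w\<^sup>2 / H\<^sup>2\<close>.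
  So the unrestricted risk is exactly \<open>w\<close>, the restricted one is \<open>w + O(H\<^sup>-\<^sup>2) = w + o(\<delta>\<^sub>n)\<close>, and
  both difference quotients have the limit of \<open>1 + \<gamma> tanh x / x\<close> at \<open>x = \<delta>\<^sub>n / a\<^sub>n \<rightarrow> 0\<close>.
  In total variation, the density of \<open>N(h, v)\<close> is at most \<open>sqrt (w / v)\<close> times that of \<open>N(h, w)\<close> when
  \<open>v \<le> w\<close>, so the distance is at most \<open>sqrt (w / v) - 1\<close>, whatever \<open>h\<close>.
\<close>

section \<open>Gaussian location laws: densities and second moments\<close>

lemma sets_gaussian_location [simp, measurable_cong]: "sets (gaussian_location v h) = sets borel"
  by (simp add: gaussian_location_def)

lemma space_gaussian_location [simp]: "space (gaussian_location v h) = UNIV"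
  by (simp add: gaussian_location_def)

lemma prob_space_gaussian_location: "v > 0 \<Longrightarrow> prob_space (gaussian_location v h)"
  unfolding gaussian_location_def by (rule prob_space_normal_density) simp

text \<open>Affine images of a standard normal variable are normal. This replaces the image measure
  by an explicit Lebesgue density, which both the Tonelli arguments and the total variation bound
  work with.\<close>

lemma location_experiment_eq_gaussian:
  assumes "w > 0"
  shows "location_experiment w h = gaussian_location w h"
proof -
  interpret prob_space "density lborel (\<lambda>x. ennreal (std_normal_density x))"
    by (rule prob_space_normal_density) simp
  have "distributed (density lborel std_normal_density) lborel (\<lambda>z. z) std_normal_density"
    unfolding distributed_def by (auto intro: distr_id2)
  from normal_density_affine[OF this, of "sqrt w" h] assms
  have "distributed (density lborel std_normal_density) lborel (\<lambda>z. h + sqrt w * z)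
          (normal_density h (sqrt w))"
    by simp
  then have "distr (density lborel std_normal_density) lborel (\<lambda>z. h + sqrt w * z)
      = gaussian_location w h"
    by (simp add: distributed_def gaussian_location_def)
  moreover have "location_experiment w h
      = distr (density lborel std_normal_density) lborel (\<lambda>z. h + sqrt w * z)"
    unfolding location_experiment_def by (rule distr_cong) simp_all
  ultimately show ?thesis by simp
qed

text \<open>The cross term is an odd central moment and vanishes. Three choices of
  \<open>(c, d)\<close> are used later: \<open>(0, 1)\<close> for the total mass,
  \<open>(1, 0)\<close> for the risk of the identity estimator, and
  \<open>(H\<^sup>2 - h\<^sup>2, 4 * v * h)\<close> for the information term.\<close>

lemma nn_integral_gaussian_location_quadratic:
  assumes "v > 0"
  shows "(\<integral>\<^sup>+ y. ennreal (normal_density h (sqrt v) y * ((y - h) * c - d)\<^sup>2) \<partial>lborel)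
           = ennreal (v * c\<^sup>2 + d\<^sup>2)"
proof -
  let ?N = "normal_density h (sqrt v)"
  have s: "0 < sqrt v" using assms by simp
  have 0: "has_bochner_integral lborel ?N 1"
    using normal_moment_even[OF s, of h 0] by simp
  have 1: "has_bochner_integral lborel (\<lambda>y. ?N y * (y - h)) 0"
    using normal_moment_odd[OF s, of h 0] by simp
  have 2: "has_bochner_integral lborel (\<lambda>y. ?N y * (y - h)\<^sup>2) v"
    using normal_moment_even[OF s, of h 1] assms by simp
  have "has_bochner_integral lborel
      (\<lambda>y. ?N y * (y - h)\<^sup>2 * c\<^sup>2 - ?N y * (y - h) * (2 * c * d) + ?N y * d\<^sup>2)
      (v * c\<^sup>2 - 0 * (2 * c * d) + 1 * d\<^sup>2)"
    by (intro has_bochner_integral_add has_bochner_integral_diff has_bochner_integral_mult_left 0 1 2)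
  also have "(\<lambda>y. ?N y * (y - h)\<^sup>2 * c\<^sup>2 - ?N y * (y - h) * (2 * c * d) + ?N y * d\<^sup>2)
      = (\<lambda>y. ?N y * ((y - h) * c - d)\<^sup>2)"
    by (simp add: fun_eq_iff power2_eq_square algebra_simps)
  finally show ?thesis
    by (subst nn_integral_eq_integral) (auto simp: has_bochner_integral_iff)
qed

section \<open>The van Trees lower bound\<close>

text \<open>
  The van Trees argument for a single observation \<open>y\<close>, where the estimator is just a number \<open>t\<close>.
  All integrands are nonnegative, so integrating over \<open>y\<close> later needs only Tonelli's theorem and no
  integrability of the estimator. Completing the square replaces Cauchy--Schwarz; the cross term is,
  up to the left-hand side, a derivative in \<open>h\<close> of a function vanishing at \<open>-H\<close> and \<open>H\<close>.
\<close>

lemma van_trees_fixed_observation: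
  fixes v H t y :: real
  assumes v: "v > 0" and H: "H > 0"
  defines "N \<equiv> \<lambda>h. normal_density h (sqrt v) y"
  shows "(\<integral>\<^sup>+ h. ennreal (2 * v * (N h * (H\<^sup>2 - h\<^sup>2)\<^sup>2) * indicator {-H..H} h) \<partial>lborel)
    \<le> (\<integral>\<^sup>+ h. ennreal (N h * ((t - h)\<^sup>2 * (H\<^sup>2 - h\<^sup>2)\<^sup>2) * indicator {-H..H} h) \<partial>lborel)
      + (\<integral>\<^sup>+ h. ennreal (N h * ((y - h) * (H\<^sup>2 - h\<^sup>2) - 4 * v * h)\<^sup>2 * indicator {-H..H} h) \<partial>lborel)"
    (is "(\<integral>\<^sup>+ h. ennreal (?L h * _) \<partial>_) \<le> (\<integral>\<^sup>+ h. ennreal (?A h * _) \<partial>_) + (\<integral>\<^sup>+ h. ennreal (?B h * _) \<partial>_)")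
proof -
  let ?I = "indicator {-H..H} :: real \<Rightarrow> real"
  have N_deriv: "(N has_real_derivative N h * ((y - h) / v)) (at h)" for h
  proof -
    have N_eq: "N = (\<lambda>h. 1 / sqrt (2 * pi * v) * exp (- (y - h)\<^sup>2 / (2 * v)))"
      using v by (simp add: N_def normal_density_def fun_eq_iff)
    have "((\<lambda>h. - (y - h)\<^sup>2 / (2 * v)) has_real_derivative (y - h) / v) (at h)"
      using v by (auto intro!: derivative_eq_intros simp: field_simps)
    from DERIV_cmult[OF DERIV_fun_exp[OF this], of "1 / sqrt (2 * pi * v)"] show ?thesis
      by (simp add: N_eq)
  qed
  have N_cont: "isCont N h" for h
    using N_deriv by (rule DERIV_isCont)
  have N_nonneg: "0 \<le> N h" for h by (simp add: N_def)
  have int: "integrable lborel (\<lambda>h. f h * ?I h)" if "\<And>h. isCont f h" for f :: "real \<Rightarrow> real"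
    using borel_integrable_atLeastAtMost'[of "-H" H f] that
    by (simp add: continuous_at_imp_continuous_on set_integrable_def mult.commute)
  \<comment> \<open>Where \<open>H\<^sup>2 - h\<^sup>2\<close> is nonzero, the factor
    \<open>(y - h) * (H\<^sup>2 - h\<^sup>2) - 4 * v * h\<close> is
    \<open>v * (H\<^sup>2 - h\<^sup>2)\<close> times the logarithmic derivative in \<open>h\<close>
    of \<open>N h * (H\<^sup>2 - h\<^sup>2)\<^sup>2\<close>. So differentiating the second factor of
    \<open>F\<close> produces the cross term, and differentiating \<open>t - h\<close> produces
    minus the left-hand side.\<close>
  define F where "F = (\<lambda>h. 2 * v * ((t - h) * (N h * (H\<^sup>2 - h\<^sup>2)\<^sup>2)))"
  define F' where "F' = (\<lambda>h. 2 * (t - h) * (N h * ((y - h) * (H\<^sup>2 - h\<^sup>2) - 4 * v * h) * (H\<^sup>2 - h\<^sup>2)) - ?L h)"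
  have F_deriv: "(F has_real_derivative F' h) (at h)" for h
    unfolding F_def F'_def using v
    by (auto intro!: derivative_eq_intros N_deriv simp: power2_eq_square field_simps)
  have F'_cont: "isCont F' h" for h
    unfolding F'_def by (intro continuous_intros N_cont)
  have F: "has_bochner_integral lborel (\<lambda>h. F' h * ?I h) (F H - F (-H))"
    by (rule has_bochner_integral_FTC_Icc_real) (use H F_deriv F'_cont in auto)
  have iL: "integrable lborel (\<lambda>h. ?L h * ?I h)"
    and iA: "integrable lborel (\<lambda>h. ?A h * ?I h)"
    and iB: "integrable lborel (\<lambda>h. ?B h * ?I h)"
    by (intro int continuous_intros N_cont)+
  have pw: "?L h + F' h \<le> ?A h + ?B h" for h
  proof -
    have "0 \<le> N h * ((t - h) * (H\<^sup>2 - h\<^sup>2) - ((y - h) * (H\<^sup>2 - h\<^sup>2) - 4 * v * h))\<^sup>2"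
      using N_nonneg by simp
    also have "\<dots> = ?A h + ?B h - (?L h + F' h)"
      unfolding F'_def by (simp add: power2_eq_square algebra_simps)
    finally show ?thesis by simp
  qed
  have "(\<integral>h. ?L h * ?I h \<partial>lborel) = (\<integral>h. ?L h * ?I h + F' h * ?I h \<partial>lborel)"
    using F iL by (simp add: has_bochner_integral_iff F_def)
  also have "\<dots> \<le> (\<integral>h. ?A h * ?I h + ?B h * ?I h \<partial>lborel)"
  proof (rule integral_mono)
    show "?L h * ?I h + F' h * ?I h \<le> ?A h * ?I h + ?B h * ?I h" for h
      using mult_right_mono[OF pw, of "?I h" h] by (simp add: distrib_right)
  qed (use F iL iA iB in \<open>auto simp: has_bochner_integral_iff\<close>)
  also have "\<dots> = (\<integral>h. ?A h * ?I h \<partial>lborel) + (\<integral>h. ?B h * ?I h \<partial>lborel)"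
    using iA iB by simp
  finally have "ennreal (\<integral>h. ?L h * ?I h \<partial>lborel)
      \<le> ennreal ((\<integral>h. ?A h * ?I h \<partial>lborel) + (\<integral>h. ?B h * ?I h \<partial>lborel))"
    by (rule ennreal_leI)
  also have "\<dots> = ennreal (\<integral>h. ?A h * ?I h \<partial>lborel) + ennreal (\<integral>h. ?B h * ?I h \<partial>lborel)"
    by (intro ennreal_plus integral_nonneg_AE) (auto simp: N_nonneg)
  finally show ?thesis
    using v by (subst (1 2 3) nn_integral_eq_integral) (auto simp: iL iA iB N_nonneg)
qed

text \<open>Integrating the bound for a fixed observation over \<open>y\<close> gives
  \<open>2 * v * Z \<le> S * Z + (v * Z + 16 * v\<^sup>2 * J)\<close>, and
  \<open>J / Z = 5 / (8 * H\<^sup>2)\<close> produces the constant 10. For fixed \<open>v\<close>,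
  Cauchy--Schwarz would give \<open>v / (1 + 10 * v / H\<^sup>2)\<close>, which exceeds this bound
  only by a term of order \<open>1 / H ^ 4\<close>.\<close>

lemma van_trees_gaussian_location:
  fixes v H S :: real and T :: "real \<Rightarrow> real"
  assumes v: "v > 0" and H: "H > 0" and T [measurable]: "T \<in> borel_measurable borel"
    and S: "\<And>h. \<bar>h\<bar> \<le> H \<Longrightarrow> (\<integral>\<^sup>+ y. ennreal ((T y - h)\<^sup>2) \<partial>gaussian_location v h) \<le> ennreal S"
    and "S \<ge> 0"
  shows "v - 10 * v\<^sup>2 / H\<^sup>2 \<le> S"
proof -
  let ?I = "indicator {-H..H} :: real \<Rightarrow> real"
  let ?q = "\<lambda>h::real. H\<^sup>2 - h\<^sup>2"
  define N where "N = (\<lambda>y h. normal_density h (sqrt v) y)"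
  have [measurable]: "case_prod N \<in> borel_measurable (borel \<Otimes>\<^sub>M borel)"
    unfolding N_def normal_density_def by measurable
  have Nn: "0 \<le> N y h" for y h by (simp add: N_def)
  have quad: "(\<integral>\<^sup>+ y. ennreal (N y h * ((y - h) * c - d)\<^sup>2) \<partial>lborel) = ennreal (v * c\<^sup>2 + d\<^sup>2)" for h c d
    unfolding N_def by (rule nn_integral_gaussian_location_quadratic[OF v])
  have one: "(\<integral>\<^sup>+ y. ennreal (N y h) \<partial>lborel) = 1" for h
    using quad[of h 0 1] by simp
  have poly: "(\<integral>\<^sup>+ h. ennreal ((\<alpha> * (?q h)\<^sup>2 + \<beta> * h\<^sup>2) * ?I h) \<partial>lborel)
      = ennreal (\<alpha> * (16 / 15 * H ^ 5) + \<beta> * (2 / 3 * H ^ 3))" if "\<alpha> \<ge> 0" "\<beta> \<ge> 0" for \<alpha> \<beta>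
  proof -
    define P where "P = (\<lambda>h::real. \<alpha> * (H ^ 4 * h - 2 / 3 * H\<^sup>2 * h ^ 3 + h ^ 5 / 5) + \<beta> * (h ^ 3 / 3))"
    have "has_bochner_integral lborel (\<lambda>h. (\<alpha> * (?q h)\<^sup>2 + \<beta> * h\<^sup>2) * ?I h) (P H - P (-H))"
      unfolding P_def
      by (rule has_bochner_integral_FTC_Icc_real)
         (use H in \<open>auto intro!: derivative_eq_intros continuous_intros
            simp: power2_eq_square power4_eq_xxxx algebra_simps eval_nat_numeral\<close>)
    moreover have "P H - P (-H) = \<alpha> * (16 / 15 * H ^ 5) + \<beta> * (2 / 3 * H ^ 3)"
      by (simp add: P_def field_simps eval_nat_numeral)
    ultimately show ?thesis
      using that by (subst nn_integral_eq_integral) (auto simp: has_bochner_integral_iff)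
  qed
  \<comment> \<open>The prior stays unnormalised: \<open>Z\<close> is the integral of
    \<open>(H\<^sup>2 - h\<^sup>2)\<^sup>2\<close> over \<open>[-H, H]\<close> and cancels at the
    end, while \<open>J\<close> is the integral of \<open>h\<^sup>2\<close> there.\<close>
  define Z where "Z = 16 / 15 * H ^ 5"
  define J where "J = 2 / 3 * H ^ 3"
  have Z: "Z > 0" and J: "J > 0" using H by (simp_all add: Z_def J_def)
  have "ennreal (2 * v * Z) = (\<integral>\<^sup>+ h. ennreal (2 * v * (?q h)\<^sup>2 * ?I h) \<partial>lborel)"
    using poly[of "2 * v" 0] v by (simp add: Z_def)
  \<comment> \<open>Inserting the total mass 1 of the density in \<open>y\<close> creates a double
    integral; after exchanging the order, the inner integral is the one bounded for fixed
    \<open>y\<close>.\<close>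
  also have "\<dots> = (\<integral>\<^sup>+ h. \<integral>\<^sup>+ y. ennreal (2 * v * (N y h * (?q h)\<^sup>2) * ?I h) \<partial>lborel \<partial>lborel)"
  proof (rule nn_integral_cong)
    fix h
    have "(\<integral>\<^sup>+ y. ennreal (2 * v * (N y h * (?q h)\<^sup>2) * ?I h) \<partial>lborel)
        = (\<integral>\<^sup>+ y. ennreal (2 * v * (?q h)\<^sup>2 * ?I h) * ennreal (N y h) \<partial>lborel)"
      using v by (intro nn_integral_cong) (simp add: ennreal_mult[symmetric] Nn ac_simps)
    then show "ennreal (2 * v * (?q h)\<^sup>2 * ?I h)
        = (\<integral>\<^sup>+ y. ennreal (2 * v * (N y h * (?q h)\<^sup>2) * ?I h) \<partial>lborel)"
      using one[of h] by (simp add: nn_integral_cmult N_def)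
  qed
  also have "\<dots> = (\<integral>\<^sup>+ y. \<integral>\<^sup>+ h. ennreal (2 * v * (N y h * (?q h)\<^sup>2) * ?I h) \<partial>lborel \<partial>lborel)"
    by (rule lborel_pair.Fubini') measurable
  also have "\<dots> \<le> (\<integral>\<^sup>+ y. (\<integral>\<^sup>+ h. ennreal (N y h * ((T y - h)\<^sup>2 * (?q h)\<^sup>2) * ?I h) \<partial>lborel)
      + (\<integral>\<^sup>+ h. ennreal (N y h * ((y - h) * ?q h - 4 * v * h)\<^sup>2 * ?I h) \<partial>lborel) \<partial>lborel)"
    unfolding N_def by (intro nn_integral_mono van_trees_fixed_observation v H)
  also have "\<dots> = (\<integral>\<^sup>+ y. \<integral>\<^sup>+ h. ennreal (N y h * ((T y - h)\<^sup>2 * (?q h)\<^sup>2) * ?I h) \<partial>lborel \<partial>lborel)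
      + (\<integral>\<^sup>+ y. \<integral>\<^sup>+ h. ennreal (N y h * ((y - h) * ?q h - 4 * v * h)\<^sup>2 * ?I h) \<partial>lborel \<partial>lborel)"
    by (rule nn_integral_add) measurable
  finally have split: "ennreal (2 * v * Z) \<le> (\<integral>\<^sup>+ y. \<integral>\<^sup>+ h. ennreal (N y h * ((T y - h)\<^sup>2 * (?q h)\<^sup>2) * ?I h) \<partial>lborel \<partial>lborel)
      + (\<integral>\<^sup>+ y. \<integral>\<^sup>+ h. ennreal (N y h * ((y - h) * ?q h - 4 * v * h)\<^sup>2 * ?I h) \<partial>lborel \<partial>lborel)" .
  have "(\<integral>\<^sup>+ y. \<integral>\<^sup>+ h. ennreal (N y h * ((T y - h)\<^sup>2 * (?q h)\<^sup>2) * ?I h) \<partial>lborel \<partial>lborel)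
      = (\<integral>\<^sup>+ h. \<integral>\<^sup>+ y. ennreal (N y h * ((T y - h)\<^sup>2 * (?q h)\<^sup>2) * ?I h) \<partial>lborel \<partial>lborel)"
    by (rule lborel_pair.Fubini'[symmetric]) measurable
  also have "\<dots> \<le> (\<integral>\<^sup>+ h. ennreal (S * (?q h)\<^sup>2 * ?I h) \<partial>lborel)"
  proof (rule nn_integral_mono)
    fix h
    have "(\<integral>\<^sup>+ y. ennreal (N y h * ((T y - h)\<^sup>2 * (?q h)\<^sup>2) * ?I h) \<partial>lborel)
        = (\<integral>\<^sup>+ y. ennreal ((?q h)\<^sup>2 * ?I h) * (ennreal (N y h) * ennreal ((T y - h)\<^sup>2)) \<partial>lborel)"
      by (intro nn_integral_cong) (simp add: ennreal_mult[symmetric] Nn ac_simps)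
    also have "\<dots> = ennreal ((?q h)\<^sup>2 * ?I h) * (\<integral>\<^sup>+ y. ennreal (N y h) * ennreal ((T y - h)\<^sup>2) \<partial>lborel)"
      by (rule nn_integral_cmult) (simp add: N_def)
    also have "(\<integral>\<^sup>+ y. ennreal (N y h) * ennreal ((T y - h)\<^sup>2) \<partial>lborel)
        = (\<integral>\<^sup>+ y. ennreal ((T y - h)\<^sup>2) \<partial>gaussian_location v h)"
      unfolding gaussian_location_def N_def by (subst nn_integral_density) auto
    also have "ennreal ((?q h)\<^sup>2 * ?I h) * \<dots> \<le> ennreal ((?q h)\<^sup>2 * ?I h) * ennreal S"
      using S[of h] by (cases "h \<in> {-H..H}") (auto intro!: mult_left_mono)
    also have "\<dots> = ennreal (S * (?q h)\<^sup>2 * ?I h)"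
      using \<open>S \<ge> 0\<close> by (simp add: ennreal_mult[symmetric] ac_simps)
    finally show "(\<integral>\<^sup>+ y. ennreal (N y h * ((T y - h)\<^sup>2 * (?q h)\<^sup>2) * ?I h) \<partial>lborel)
        \<le> ennreal (S * (?q h)\<^sup>2 * ?I h)" .
  qed
  also have "\<dots> = ennreal (S * Z)"
    using poly[of S 0] \<open>S \<ge> 0\<close> by (simp add: Z_def)
  finally have risk: "(\<integral>\<^sup>+ y. \<integral>\<^sup>+ h. ennreal (N y h * ((T y - h)\<^sup>2 * (?q h)\<^sup>2) * ?I h) \<partial>lborel \<partial>lborel) \<le> ennreal (S * Z)" .
  have "(\<integral>\<^sup>+ y. \<integral>\<^sup>+ h. ennreal (N y h * ((y - h) * ?q h - 4 * v * h)\<^sup>2 * ?I h) \<partial>lborel \<partial>lborel)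
      = (\<integral>\<^sup>+ h. \<integral>\<^sup>+ y. ennreal (N y h * ((y - h) * ?q h - 4 * v * h)\<^sup>2 * ?I h) \<partial>lborel \<partial>lborel)"
    by (rule lborel_pair.Fubini'[symmetric]) measurable
  also have "\<dots> = (\<integral>\<^sup>+ h. ennreal ((v * (?q h)\<^sup>2 + 16 * v\<^sup>2 * h\<^sup>2) * ?I h) \<partial>lborel)"
  proof (rule nn_integral_cong)
    fix h
    have "(\<integral>\<^sup>+ y. ennreal (N y h * ((y - h) * ?q h - 4 * v * h)\<^sup>2 * ?I h) \<partial>lborel)
        = (\<integral>\<^sup>+ y. ennreal (N y h * ((y - h) * ?q h - 4 * v * h)\<^sup>2) * ennreal (?I h) \<partial>lborel)"
      by (intro nn_integral_cong) (simp add: ennreal_mult[symmetric] Nn)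
    also have "\<dots> = ennreal (v * (?q h)\<^sup>2 + (4 * v * h)\<^sup>2) * ennreal (?I h)"
      by (simp add: nn_integral_multc quad N_def[symmetric])
    also have "\<dots> = ennreal ((v * (?q h)\<^sup>2 + 16 * v\<^sup>2 * h\<^sup>2) * ?I h)"
      using v by (simp add: ennreal_mult[symmetric] power_mult_distrib del: ennreal_plus)
    finally show "(\<integral>\<^sup>+ y. ennreal (N y h * ((y - h) * ?q h - 4 * v * h)\<^sup>2 * ?I h) \<partial>lborel)
        = ennreal ((v * (?q h)\<^sup>2 + 16 * v\<^sup>2 * h\<^sup>2) * ?I h)" .
  qed
  also have "\<dots> = ennreal (v * Z + 16 * v\<^sup>2 * J)"
    using poly[of v "16 * v\<^sup>2"] v by (simp add: Z_def J_def)
  finally have info: "(\<integral>\<^sup>+ y. \<integral>\<^sup>+ h. ennreal (N y h * ((y - h) * ?q h - 4 * v * h)\<^sup>2 * ?I h) \<partial>lborel \<partial>lborel)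
      = ennreal (v * Z + 16 * v\<^sup>2 * J)" .
  have "ennreal (2 * v * Z) \<le> ennreal (S * Z) + ennreal (v * Z + 16 * v\<^sup>2 * J)"
    using split risk unfolding info by (blast intro: order_trans add_right_mono)
  also have "\<dots> = ennreal (S * Z + (v * Z + 16 * v\<^sup>2 * J))"
    using \<open>S \<ge> 0\<close> v Z J by (intro ennreal_plus[symmetric]) auto
  finally have "2 * v * Z \<le> S * Z + (v * Z + 16 * v\<^sup>2 * J)"
    using \<open>S \<ge> 0\<close> v Z J by (subst (asm) ennreal_le_iff) auto
  moreover have "16 * v\<^sup>2 * J = (10 * v\<^sup>2 / H\<^sup>2) * Z"
    using H by (simp add: Z_def J_def field_simps eval_nat_numeral)
  ultimately have "(v - 10 * v\<^sup>2 / H\<^sup>2) * Z \<le> S * Z"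
    by (simp add: algebra_simps)
  then show ?thesis using Z by simp
qed

section \<open>Minimax risk of the Gaussian location experiment\<close>

lemma minimax_risk_location_le:
  assumes "w > 0"
  shows "enn2real (minimax_risk (location_experiment w) \<Theta>) \<le> w"
proof (rule enn2real_leI)
  have "(\<integral>\<^sup>+ y. ennreal ((y - h)\<^sup>2) \<partial>location_experiment w h) = ennreal w" for h
    using nn_integral_gaussian_location_quadratic[OF assms, of h 1 0]
    unfolding location_experiment_eq_gaussian[OF assms] gaussian_location_def
    by (subst nn_integral_density) (auto simp: ennreal_mult)
  then have "(SUP h\<in>\<Theta>. \<integral>\<^sup>+ y. ennreal ((y - h)\<^sup>2) \<partial>location_experiment w h) \<le> ennreal w"
    by (intro SUP_least) simp
  then show "minimax_risk (location_experiment w) \<Theta> \<le> ennreal w"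
    unfolding minimax_risk_def by (intro INF_lower2[where i = "\<lambda>y. y"]) auto
qed (use assms in simp)

text \<open>Allowing any parameter set that contains \<open>[-H, H]\<close> serves both risks: the
  restricted one with equality of sets, the unrestricted one with \<open>H\<close> still
  free.\<close>

lemma minimax_risk_location_ge:
  assumes w: "w > 0" and H: "H > 0" and \<Theta>: "{h. \<bar>h\<bar> \<le> H} \<subseteq> \<Theta>"
  shows "w - 10 * w\<^sup>2 / H\<^sup>2 \<le> enn2real (minimax_risk (location_experiment w) \<Theta>)"
proof -
  have "ennreal (w - 10 * w\<^sup>2 / H\<^sup>2) \<le> minimax_risk (location_experiment w) \<Theta>"
    unfolding minimax_risk_def
  proof (rule INF_greatest)
    fix T :: "real \<Rightarrow> real" assume T: "T \<in> borel_measurable borel"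
    let ?S = "SUP h\<in>\<Theta>. \<integral>\<^sup>+ y. ennreal ((T y - h)\<^sup>2) \<partial>location_experiment w h"
    show "ennreal (w - 10 * w\<^sup>2 / H\<^sup>2) \<le> ?S"
    proof (cases ?S)
      case (real S)
      have "w - 10 * w\<^sup>2 / H\<^sup>2 \<le> S"
      proof (rule van_trees_gaussian_location[OF w H T])
        fix h assume "\<bar>h\<bar> \<le> H"
        then have "h \<in> \<Theta>" using \<Theta> by auto
        then have "(\<integral>\<^sup>+ y. ennreal ((T y - h)\<^sup>2) \<partial>location_experiment w h) \<le> ?S"
          by (rule SUP_upper)
        then show "(\<integral>\<^sup>+ y. ennreal ((T y - h)\<^sup>2) \<partial>gaussian_location w h) \<le> ennreal S"
          using real(2) by (simp add: location_experiment_eq_gaussian[OF w])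
      qed (rule real(1))
      then show ?thesis unfolding real(2) by (rule ennreal_leI)
    next
      case top
      then show ?thesis by (simp only: top_greatest)
    qed
  qed
  then have "enn2real (ennreal (w - 10 * w\<^sup>2 / H\<^sup>2)) \<le> enn2real (minimax_risk (location_experiment w) \<Theta>)"
    using minimax_risk_location_finite by (intro enn2real_mono) auto
  \<comment> \<open>\<open>ennreal\<close> truncates negative numbers to 0, so the bound survives
    the conversion even when \<open>w - 10 * w\<^sup>2 / H\<^sup>2\<close> is negative.\<close>
  moreover have "x \<le> enn2real (ennreal x)" for x
    by (cases "x \<ge> 0") (auto simp: ennreal_neg)
  ultimately show ?thesis by (rule order_trans[rotated])
qed

text \<open>The whole line contains every interval \<open>[-H, H]\<close>, so letting
  \<open>H\<close> tend to infinity in the lower bound closes the gap to the risk of the identity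
  estimator.\<close>

lemma minimax_risk_location_UNIV:
  assumes "w > 0"
  shows "enn2real (minimax_risk (location_experiment w) UNIV) = w"
proof (rule antisym[OF minimax_risk_location_le[OF assms]])
  have "((\<lambda>H. w - 10 * w\<^sup>2 / H\<^sup>2) \<longlongrightarrow> w - 0) at_top"
    by (intro tendsto_diff tendsto_const tendsto_divide_0[OF tendsto_const]
          filterlim_at_top_imp_at_infinity filterlim_pow_at_top filterlim_ident) simp
  moreover have "\<forall>\<^sub>F H in at_top. w - 10 * w\<^sup>2 / H\<^sup>2 \<le> enn2real (minimax_risk (location_experiment w) UNIV)"
    using eventually_gt_at_top[of 0] by eventually_elim (intro minimax_risk_location_ge assms, auto)
  ultimately show "w \<le> enn2real (minimax_risk (location_experiment w) UNIV)"
    by (intro tendsto_upperbound[where F = at_top]) auto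
qed

section \<open>Total variation between normal laws with a common mean\<close>

text \<open>The exponential factor is smaller for the smaller standard deviation, so only the ratio
  of the normalising constants remains; equality holds at \<open>y = h\<close>.\<close>

lemma normal_density_le_ratio:
  assumes "0 < \<sigma>" "\<sigma> \<le> \<tau>"
  shows "normal_density h \<sigma> y \<le> \<tau> / \<sigma> * normal_density h \<tau> y"
proof -
  have "(y - h)\<^sup>2 / (2 * \<tau>\<^sup>2) \<le> (y - h)\<^sup>2 / (2 * \<sigma>\<^sup>2)"
    using assms by (intro divide_left_mono) (auto intro!: power_mono)
  then have "exp (- (y - h)\<^sup>2 / (2 * \<sigma>\<^sup>2)) \<le> exp (- (y - h)\<^sup>2 / (2 * \<tau>\<^sup>2))" by simp
  then have "1 / sqrt (2 * pi * \<sigma>\<^sup>2) * exp (- (y - h)\<^sup>2 / (2 * \<sigma>\<^sup>2))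
      \<le> 1 / sqrt (2 * pi * \<sigma>\<^sup>2) * exp (- (y - h)\<^sup>2 / (2 * \<tau>\<^sup>2))"
    by (intro mult_left_mono) auto
  also have "\<dots> = \<tau> / \<sigma> * normal_density h \<tau> y"
    using assms by (simp add: normal_density_def real_sqrt_mult)
  finally show ?thesis by (simp add: normal_density_def)
qed

lemma measure_gaussian_location_diff_le:
  assumes v: "0 < v" "v \<le> w" and [measurable]: "A \<in> sets borel"
  shows "measure (gaussian_location v h) A - measure (gaussian_location w h) A \<le> sqrt (w / v) - 1"
proof -
  interpret V: prob_space "gaussian_location v h" using v by (intro prob_space_gaussian_location) simp
  interpret W: prob_space "gaussian_location w h" using v by (intro prob_space_gaussian_location) simp
  have r: "1 \<le> sqrt (w / v)" using v by simp
  have "emeasure (gaussian_location v h) A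
      = (\<integral>\<^sup>+ y. ennreal (normal_density h (sqrt v) y) * indicator A y \<partial>lborel)"
    unfolding gaussian_location_def by (subst emeasure_density) auto
  also have "\<dots> \<le> (\<integral>\<^sup>+ y. ennreal (sqrt (w / v)) * (ennreal (normal_density h (sqrt w) y) * indicator A y) \<partial>lborel)"
    using normal_density_le_ratio[of "sqrt v" "sqrt w" h] v
    by (intro nn_integral_mono)
       (auto simp: real_sqrt_divide ennreal_mult[symmetric] intro!: ennreal_leI split: split_indicator)
  also have "\<dots> = ennreal (sqrt (w / v)) * emeasure (gaussian_location w h) A"
    unfolding gaussian_location_def by (subst emeasure_density, simp, simp, rule nn_integral_cmult) auto
  finally have "measure (gaussian_location v h) A \<le> sqrt (w / v) * measure (gaussian_location w h) A"
    using v by (simp add: V.emeasure_eq_measure W.emeasure_eq_measure ennreal_mult[symmetric])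
  moreover have "(sqrt (w / v) - 1) * measure (gaussian_location w h) A \<le> (sqrt (w / v) - 1) * 1"
    using r W.prob_le_1 by (intro mult_left_mono) auto
  ultimately show ?thesis by (simp add: algebra_simps)
qed

text \<open>Passing to the complement of \<open>A\<close> reverses the sign of the difference, so
  the one-sided bound for all Borel sets gives the two-sided one.\<close>

lemma abs_measure_gaussian_location_diff_le:
  assumes v: "0 < v" "v \<le> w" and A [measurable]: "A \<in> sets borel"
  shows "\<bar>measure (gaussian_location v h) A - measure (gaussian_location w h) A\<bar> \<le> sqrt (w / v) - 1"
proof -
  interpret V: prob_space "gaussian_location v h" using v by (intro prob_space_gaussian_location) simp
  interpret W: prob_space "gaussian_location w h" using v by (intro prob_space_gaussian_location) simp
  have "measure (gaussian_location v h) (UNIV - A) = 1 - measure (gaussian_location v h) A"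
    using V.prob_compl[of A] by simp
  moreover have "measure (gaussian_location w h) (UNIV - A) = 1 - measure (gaussian_location w h) A"
    using W.prob_compl[of A] by simp
  ultimately show ?thesis
    using measure_gaussian_location_diff_le[OF v A, of h]
      measure_gaussian_location_diff_le[OF v, of "UNIV - A" h] A by auto
qed

text \<open>The maximum makes the bound symmetric, since perturbed variances can lie on either side
  of \<open>v\<close>.\<close>

lemma tv_dist_gaussian_location_bounds:
  assumes "0 < v" "0 < w"
  shows "0 \<le> tv_dist (gaussian_location v h) (gaussian_location w h)"
    and "tv_dist (gaussian_location v h) (gaussian_location w h) \<le> sqrt (max (w / v) (v / w)) - 1"
proof -
  have le: "\<bar>measure (gaussian_location v h) A - measure (gaussian_location w h) A\<bar>
      \<le> sqrt (max (w / v) (v / w)) - 1" if A: "A \<in> sets borel" for A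
  proof (cases "v \<le> w")
    case True
    from abs_measure_gaussian_location_diff_le[OF assms(1) True A, of h] show ?thesis
      by (smt (verit) max.cobounded1 real_sqrt_le_iff)
  next
    case False
    then have "w \<le> v" by simp
    from abs_measure_gaussian_location_diff_le[OF assms(2) this A, of h] show ?thesis
      by (smt (verit) max.cobounded2 real_sqrt_le_iff)
  qed
  then show "tv_dist (gaussian_location v h) (gaussian_location w h) \<le> sqrt (max (w / v) (v / w)) - 1"
    unfolding tv_dist_def by (intro cSUP_least) auto
  \<comment> \<open>The supremum is real-valued, so boundedness must be supplied; the empty set
    contributes the value 0.\<close>
  show "0 \<le> tv_dist (gaussian_location v h) (gaussian_location w h)"
    unfolding tv_dist_def using le by (intro cSUP_upper2[where x = "{}"] bdd_aboveI2) auto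
qed

text \<open>The bound \<open>?b n\<close> does not involve \<open>h\<close>, so it also bounds the
  supremum over all translations.\<close>

lemma SUP_tv_dist_location_tendsto_0:
  assumes v: "v > 0" and w: "w \<longlonglongrightarrow> v"
  shows "(\<lambda>n. SUP h. tv_dist (location_experiment (w n) h) (gaussian_location v h)) \<longlonglongrightarrow> 0"
proof -
  let ?b = "\<lambda>n. sqrt (max (v / w n) (w n / v)) - 1"
  have "(?b \<longlongrightarrow> sqrt (max (v / v) (v / v)) - 1) sequentially"
    using v by (intro tendsto_intros w) auto
  then have b: "?b \<longlonglongrightarrow> 0" using v by simp
  have pos: "\<forall>\<^sub>F n in sequentially. w n > 0"
    using order_tendstoD(1)[OF w v] .
  then have upper: "\<forall>\<^sub>F n in sequentially. (SUP h. tv_dist (location_experiment (w n) h) (gaussian_location v h)) \<le> ?b n"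
    by eventually_elim
       (use v in \<open>auto intro!: cSUP_least tv_dist_gaussian_location_bounds simp: location_experiment_eq_gaussian\<close>)
  from pos have lower: "\<forall>\<^sub>F n in sequentially. 0 \<le> (SUP h. tv_dist (location_experiment (w n) h) (gaussian_location v h))"
  proof eventually_elim
    case (elim n)
    then show ?case
      using tv_dist_gaussian_location_bounds[OF elim v]
      by (intro cSUP_upper2[where x = 0] bdd_aboveI2[where M = "?b n"])
         (auto simp: location_experiment_eq_gaussian)
  qed
  show ?thesis by (rule tendsto_sandwich[OF lower upper tendsto_const b])
qed

section \<open>The perturbed variance: monotonicity, limit and local slope\<close>

lemma strict_mono_perturbed_variance:
  assumes "0 < \<gamma>" "0 < a"
  shows "strict_mono (perturbed_variance \<gamma> v0 a)"
proof (rule strict_monoI)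
  fix x y :: real assume "x < y"
  then have "tanh ((x - v0) / a) \<le> tanh ((y - v0) / a)"
    using assms by (simp add: divide_right_mono)
  then have "\<gamma> * a * tanh ((x - v0) / a) \<le> \<gamma> * a * tanh ((y - v0) / a)"
    using assms by (intro mult_left_mono) auto
  with \<open>x < y\<close> show "perturbed_variance \<gamma> v0 a x < perturbed_variance \<gamma> v0 a y"
    by (simp add: perturbed_variance_def)
qed

text \<open>Since \<open>tanh\<close> is bounded by 1, the perturbation is at most
  \<open>\<bar>\<gamma> * a n\<bar>\<close> at any argument. The argument may move with
  \<open>n\<close>: it is constant for total variation and \<open>v0 + \<delta> n\<close> for the
  risks.\<close>

lemma perturbed_variance_tendsto:
  assumes a: "a \<longlonglongrightarrow> 0" and v: "v \<longlonglongrightarrow> l"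
  shows "(\<lambda>n. perturbed_variance \<gamma> v0 (a n) (v n)) \<longlonglongrightarrow> l"
proof -
  have "(\<lambda>n. \<gamma> * (a n * tanh ((v n - v0) / a n))) \<longlonglongrightarrow> \<gamma> * 0"
  proof (intro tendsto_mult tendsto_const Lim_null_comparison[OF _ tendsto_rabs_zero[OF a]])
    show "\<forall>\<^sub>F n in sequentially. norm (a n * tanh ((v n - v0) / a n)) \<le> \<bar>a n\<bar>"
      using tanh_real_bounds by (intro always_eventually allI)
        (auto simp: abs_mult abs_le_iff intro!: mult_left_le less_imp_le[OF tanh_real_lt_1]
           order_trans[OF _ less_imp_le[OF tanh_real_gt_neg1]])
  qed
  from tendsto_add[OF v this] show ?thesis
    by (simp add: perturbed_variance_def mult.assoc)
qed

text \<open>The perturbation vanishes uniformly, yet its slope at \<open>v0\<close> is \<gamma> for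
  every \<open>n\<close>. Increments much shorter than \<open>a n\<close> stay where
  \<open>tanh\<close> is nearly linear and see this slope.\<close>

lemma perturbed_variance_difference_quotient:
  assumes "\<And>n. a n > 0" "\<And>n. \<delta> n > 0" and lim: "(\<lambda>n. \<delta> n / a n) \<longlonglongrightarrow> 0"
  shows "(\<lambda>n. (perturbed_variance \<gamma> v0 (a n) (v0 + \<delta> n) - v0) / \<delta> n) \<longlonglongrightarrow> 1 + \<gamma>"
proof -
  have "(tanh has_real_derivative 1) (at 0)"
    by (auto intro!: derivative_eq_intros)
  then have "((\<lambda>x::real. tanh x / x) \<longlongrightarrow> 1) (at 0)"
    by (simp add: DERIV_def)
  \<comment> \<open>Positivity of \<open>\<delta> n\<close> and \<open>a n\<close> keeps the ratio
    away from the point 0 itself, as the punctured filter requires.\<close>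
  moreover have "filterlim (\<lambda>n. \<delta> n / a n) (at 0) sequentially"
    using lim assms by (auto simp: filterlim_at less_imp_neq[symmetric])
  ultimately have "(\<lambda>n. tanh (\<delta> n / a n) / (\<delta> n / a n)) \<longlonglongrightarrow> 1"
    by (rule filterlim_compose)
  then have "(\<lambda>n. 1 + \<gamma> * (tanh (\<delta> n / a n) / (\<delta> n / a n))) \<longlonglongrightarrow> 1 + \<gamma> * 1"
    by (intro tendsto_intros)
  moreover have "1 + \<gamma> * (tanh (\<delta> n / a n) / (\<delta> n / a n))
      = (perturbed_variance \<gamma> v0 (a n) (v0 + \<delta> n) - v0) / \<delta> n" for n
    using assms(1,2)[of n] by (simp add: perturbed_variance_def field_simps)
  ultimately show ?thesis by simp
qed

section \<open>Transfer from variances to risks\<close>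

text \<open>The risk lies between \<open>w n - 10 * (w n)\<^sup>2 / (H n)\<^sup>2\<close> and
  \<open>w n\<close>, and convergence of \<open>w\<close> keeps the factor
  \<open>(w n)\<^sup>2\<close> bounded. It is applied to the variances at
  \<open>v0 + \<delta> n\<close> and to the constant \<open>v0\<close>.\<close>

lemma restricted_risk_error_negligible:
  assumes \<delta>: "\<And>n. \<delta> n > 0" and H: "filterlim H at_top sequentially"
    and small: "(\<lambda>n. 1 / (H n)\<^sup>2) \<in> o[sequentially](\<delta>)"
    and w: "\<And>n. w n > 0" "w \<longlonglongrightarrow> l"
  shows "(\<lambda>n. (enn2real (minimax_risk (location_experiment (w n)) {h. \<bar>h\<bar> \<le> H n}) - w n) / \<delta> n) \<longlonglongrightarrow> 0"
proof (rule Lim_null_comparison)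
  have "(\<lambda>n. (1 / (H n)\<^sup>2) / \<delta> n) \<longlonglongrightarrow> 0"
    using small by (rule smalloD_tendsto)
  then have "(\<lambda>n. 10 * (w n)\<^sup>2 * ((1 / (H n)\<^sup>2) / \<delta> n)) \<longlonglongrightarrow> 10 * l\<^sup>2 * 0"
    by (intro tendsto_intros w)
  then show "(\<lambda>n. 10 * (w n)\<^sup>2 * ((1 / (H n)\<^sup>2) / \<delta> n)) \<longlonglongrightarrow> 0" by simp
  have "\<forall>\<^sub>F n in sequentially. H n > 0"
    using H by (simp add: filterlim_at_top_dense)
  then show "\<forall>\<^sub>F n in sequentially.
      norm ((enn2real (minimax_risk (location_experiment (w n)) {h. \<bar>h\<bar> \<le> H n}) - w n) / \<delta> n)
        \<le> 10 * (w n)\<^sup>2 * ((1 / (H n)\<^sup>2) / \<delta> n)"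
  proof eventually_elim
    case (elim n)
    let ?R = "enn2real (minimax_risk (location_experiment (w n)) {h. \<bar>h\<bar> \<le> H n})"
    have "\<bar>?R - w n\<bar> \<le> 10 * (w n)\<^sup>2 / (H n)\<^sup>2"
      using minimax_risk_location_le[OF w(1)[of n], of "{h. \<bar>h\<bar> \<le> H n}"]
        minimax_risk_location_ge[OF w(1)[of n] elim order_refl] by linarith
    then have "\<bar>?R - w n\<bar> / \<delta> n \<le> 10 * (w n)\<^sup>2 / (H n)\<^sup>2 / \<delta> n"
      using \<delta>[of n] by (intro divide_right_mono) auto
    then show ?case using \<delta>[of n] by simp
  qed
qed

theorem proposition4p12:
  fixes v0 \<gamma> :: real and a :: "nat \<Rightarrow> real" and K :: "real set"
  assumes "v0 > 0" and "0 < \<gamma>" and "\<gamma> < 1"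
    and "\<And>n. a n > 0" and "decseq a" and "a \<longlonglongrightarrow> 0"
    and "compact K" and "K \<subseteq> {0<..}" and "v0 \<in> interior K"
  shows "(\<forall>n. strict_mono_on K (perturbed_variance \<gamma> v0 (a n)))
    \<and> (\<forall>v\<in>K. (\<lambda>n. SUP h. tv_dist (location_experiment (perturbed_variance \<gamma> v0 (a n) v) h)
                                   (gaussian_location v h)) \<longlonglongrightarrow> 0)
    \<and> (\<forall>\<delta>::nat \<Rightarrow> real. (\<forall>n. \<delta> n > 0) \<longrightarrow> (\<lambda>n. \<delta> n / a n) \<longlonglongrightarrow> 0 \<longrightarrow>
         (\<lambda>n. (risk_unrestricted \<gamma> v0 a n (v0 + \<delta> n) - risk_unrestricted \<gamma> v0 a n v0) / \<delta> n)
           \<longlonglongrightarrow> 1 + \<gamma>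
       \<and> (\<forall>H::nat \<Rightarrow> real. filterlim H at_top sequentially \<longrightarrow>
           (\<lambda>n. 1 / (H n)\<^sup>2) \<in> o[sequentially](\<delta>) \<longrightarrow>
           (\<lambda>n. (risk_restricted \<gamma> v0 a n (H n) (v0 + \<delta> n)
                   - risk_restricted \<gamma> v0 a n (H n) v0) / \<delta> n) \<longlonglongrightarrow> 1 + \<gamma>))"
proof (intro conjI allI ballI impI)
  show "strict_mono_on K (perturbed_variance \<gamma> v0 (a n))" for n
    using strict_mono_perturbed_variance[OF assms(2,4)] by (simp add: strict_mono_on_def strict_mono_def)
  show "(\<lambda>n. SUP h. tv_dist (location_experiment (perturbed_variance \<gamma> v0 (a n) v) h)
      (gaussian_location v h)) \<longlonglongrightarrow> 0" if "v \<in> K" for v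
    using that assms by (intro SUP_tv_dist_location_tendsto_0 perturbed_variance_tendsto) auto
next
  fix \<delta> :: "nat \<Rightarrow> real"
  assume \<delta>: "\<forall>n. \<delta> n > 0" and lim: "(\<lambda>n. \<delta> n / a n) \<longlonglongrightarrow> 0"
  define w where "w = (\<lambda>n. perturbed_variance \<gamma> v0 (a n) (v0 + \<delta> n))"
  have w0: "perturbed_variance \<gamma> v0 (a n) v0 = v0" for n
    by (simp add: perturbed_variance_def)
  \<comment> \<open>As \<open>tanh 0 = 0\<close>, the variance at \<open>v0\<close> is unperturbed;
    monotonicity then gives \<open>w n > v0 > 0\<close> for every \<open>n\<close>.\<close>
  have w_pos: "w n > 0" for n
    using strict_monoD[OF strict_mono_perturbed_variance[OF assms(2,4)], of v0 "v0 + \<delta> n" v0 n]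
      \<delta> w0 assms(1) by (auto simp: w_def intro: less_trans)
  have quot: "(\<lambda>n. (w n - v0) / \<delta> n) \<longlonglongrightarrow> 1 + \<gamma>"
    unfolding w_def using assms(4) \<delta> lim by (intro perturbed_variance_difference_quotient) auto
  show "(\<lambda>n. (risk_unrestricted \<gamma> v0 a n (v0 + \<delta> n) - risk_unrestricted \<gamma> v0 a n v0) / \<delta> n)
      \<longlonglongrightarrow> 1 + \<gamma>"
    using quot minimax_risk_location_UNIV[OF w_pos] minimax_risk_location_UNIV[OF assms(1)]
    by (simp add: risk_unrestricted_def w0 w_def)
  fix H :: "nat \<Rightarrow> real"
  assume H: "filterlim H at_top sequentially" and small: "(\<lambda>n. 1 / (H n)\<^sup>2) \<in> o[sequentially](\<delta>)"
  have "(\<lambda>n. \<delta> n / a n * a n) \<longlonglongrightarrow> 0 * 0"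
    using lim assms(6) by (rule tendsto_mult)
  then have "\<delta> \<longlonglongrightarrow> 0"
    using assms(4) by (simp add: less_imp_neq[symmetric])
  then have "(\<lambda>n. v0 + \<delta> n) \<longlonglongrightarrow> v0 + 0"
    by (intro tendsto_intros)
  then have w_lim: "w \<longlonglongrightarrow> v0"
    unfolding w_def using assms(6) by (intro perturbed_variance_tendsto) auto
  note err = restricted_risk_error_negligible[OF _ H small]
  have "(\<lambda>n. (risk_restricted \<gamma> v0 a n (H n) (v0 + \<delta> n) - w n) / \<delta> n) \<longlonglongrightarrow> 0"
    unfolding risk_restricted_def w_def[symmetric]
    using err[OF _ w_pos w_lim] \<delta> by (simp add: w_def)
  moreover have "(\<lambda>n. (risk_restricted \<gamma> v0 a n (H n) v0 - v0) / \<delta> n) \<longlonglongrightarrow> 0"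
    unfolding risk_restricted_def w0
    using err[OF _ _ tendsto_const] \<delta> assms(1) by simp
  \<comment> \<open>The restricted quotient is the variance quotient plus the difference of two
    approximation errors, each negligible on the scale \<open>\<delta> n\<close>.\<close>
  ultimately have "(\<lambda>n. (w n - v0) / \<delta> n
      + (risk_restricted \<gamma> v0 a n (H n) (v0 + \<delta> n) - w n) / \<delta> n
      - (risk_restricted \<gamma> v0 a n (H n) v0 - v0) / \<delta> n) \<longlonglongrightarrow> 1 + \<gamma> + 0 - 0"
    by (intro tendsto_intros quot)
  then show "(\<lambda>n. (risk_restricted \<gamma> v0 a n (H n) (v0 + \<delta> n)
      - risk_restricted \<gamma> v0 a n (H n) v0) / \<delta> n) \<longlonglongrightarrow> 1 + \<gamma>"
    by (simp add: add_divide_distrib[symmetric] diff_divide_distrib[symmetric])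
qed

end
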